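(* Let $\mathcal{X}\subset\mathbb{R}$ be countably infinite and let $(\mathcal{Y}_x)_{x\in\mathcal{X}}$ be an independent family of random closed subsets of $\mathbb{R}$ with $P[\mathcal{Y}_x=\emptyset]=0$ for all $x\in\mathcal{X}$. Assume that each $\mathcal{Y}_x$ is stationary, i.e. for every $a\in\mathbb{R}$ the random set $\mathcal{Y}_x+a$ has the same distribution as $\mathcal{Y}_x$, and that each $\mathcal{Y}_x$, $x\in\mathcal{X}$, is almost surely countable. For $m\in\mathbb{N}_0=\{0,1,2,\ldots\}$ let $P_m$ be the event that there exists a polynomial function $f:\mathbb{R}\to\mathbb{R}$ of degree at most $m$ with $f(x)\in\mathcal{Y}_x$ for all $x\in\mathcal{X}$. Then $P[P_m]=0$ for all $m\in\mathbb{N}_0$.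
   Context: All random objects are defined on a complete probability space $(\Omega,\mathcal{F},P)$. A random closed set is a random variable with values in the space of closed subsets of $\mathbb{R}$, equipped with the Borel $\sigma$-algebra generated by the Fell topology. "Countable" means finite or countably infinite. That $P_m\in\mathcal{F}$ follows from the completeness of the probability space and is part of the assertion. *)

theory Defs
  imports "HOL-Probability.Probability" "HOL-Computational_Algebra.Polynomial"
begin

definition fell_topology :: "'a::topological_space set topology" where
  "fell_topology = topology_generated_by
     ({{F. closed F \<and> F \<inter> K = {}} | K. compact K} \<union>
      {{F. closed F \<and> F \<inter> G \<noteq> {}} | G. open G})"

definition fell_borel :: "'a::topological_space set measure" where
  "fell_borel = sigma {F. closed F} {U. openin fell_topology U}"

lemma topspace_fell_topology: "topspace fell_topology = {F. closed F}"
proof -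
  let ?B = "{{F :: 'a set. closed F \<and> F \<inter> K = {}} | K. compact K} \<union>
      {{F. closed F \<and> F \<inter> G \<noteq> {}} | G. open G}"
  have "\<Union>?B = {F. closed F}"
  proof (rule equalityI)
    have "U \<subseteq> {F. closed F}" if "U \<in> ?B" for U
      using that by (elim UnE CollectE exE conjE) (simp_all add: Collect_mono_iff)
    then show "\<Union>?B \<subseteq> {F. closed F}" by (rule Union_least)
    have "{F :: 'a set. closed F} \<in> ?B"
      by (rule UnI1, rule CollectI, rule exI[of _ "{}"]) simp
    then show "{F. closed F} \<subseteq> \<Union>?B" by (rule Union_upper)
  qed
  then show ?thesis
    unfolding fell_topology_def topology_generated_by_topspace .
qed

lemma openin_fell_subset: "{U. openin fell_topology U} \<subseteq> Pow {F. closed F}"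
proof
  fix U :: "'a set set"
  assume "U \<in> {U. openin fell_topology U}"
  then have "U \<subseteq> topspace fell_topology"
    by (simp only: mem_Collect_eq openin_subset)
  then show "U \<in> Pow {F. closed F}"
    by (simp only: topspace_fell_topology Pow_iff)
qed

lemma space_fell_borel: "space fell_borel = {F. closed F}"
  unfolding fell_borel_def by (rule space_measure_of[OF openin_fell_subset])

lemma sets_fell_borel:
  "sets fell_borel = sigma_sets {F. closed F} {U. openin fell_topology U}"
  unfolding fell_borel_def by (rule sets_measure_of[OF openin_fell_subset])

(* Measurability into fell_borel includes that the values are closed sets. *)
definition random_closed_set :: "'w measure \<Rightarrow> ('w \<Rightarrow> 'a::topological_space set) \<Rightarrow> bool" where
  "random_closed_set M Y \<longleftrightarrow> Y \<in> measurable M fell_borel"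

lemma openin_fell_miss:
  assumes "compact K"
  shows "openin fell_topology {F. closed F \<and> F \<inter> K = {}}"
  unfolding fell_topology_def
  by (rule topology_generated_by_Basis, rule UnI1, rule CollectI, rule exI[of _ K])
    (simp add: assms)

lemma openin_fell_hit:
  assumes "open G"
  shows "openin fell_topology {F. closed F \<and> F \<inter> G \<noteq> {}}"
  unfolding fell_topology_def
  by (rule topology_generated_by_Basis, rule UnI2, rule CollectI, rule exI[of _ G])
    (simp add: assms)

lemma closed_shift_iff: "closed ((\<lambda>y. y + a) ` F) \<longleftrightarrow> closed F" for a :: real
proof
  assume "closed ((\<lambda>y. y + a) ` F)"
  then have "closed ((\<lambda>y. - a + y) ` (\<lambda>y. y + a) ` F)"
    by (rule closed_translation)
  then show "closed F" by (simp add: image_image)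
next
  assume "closed F"
  then have "closed ((\<lambda>y. a + y) ` F)" by (rule closed_translation)
  then show "closed ((\<lambda>y. y + a) ` F)" by (simp add: add.commute)
qed

lemma shift_Int_empty_iff:
  "(\<lambda>y. y + a) ` F \<inter> K = {} \<longleftrightarrow> F \<inter> (\<lambda>y. - a + y) ` K = {}" for a :: real
proof -
  have "y \<in> (\<lambda>y. - a + y) ` K \<longleftrightarrow> y + a \<in> K" for y
  proof
    assume "y + a \<in> K"
    then show "y \<in> (\<lambda>y. - a + y) ` K" by (rule rev_image_eqI) simp
  qed auto
  then show ?thesis unfolding disjoint_iff by blast
qed

lemma continuous_map_fell_shift:
  "continuous_map fell_topology fell_topology (\<lambda>F. (\<lambda>y. y + a) ` F)"
  (is "continuous_map _ _ ?s") for a :: real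
proof -
  let ?B = "{{F :: real set. closed F \<and> F \<inter> K = {}} | K. compact K} \<union>
      {{F. closed F \<and> F \<inter> G \<noteq> {}} | G. open G}"
  have "continuous_map fell_topology (topology_generated_by ?B) ?s"
  proof (rule continuous_on_generated_topo)
    fix U assume "U \<in> ?B"
    then consider K where "compact K" "U = {F. closed F \<and> F \<inter> K = {}}"
      | G where "open G" "U = {F. closed F \<and> F \<inter> G \<noteq> {}}"
      by blast
    then show "openin fell_topology (?s -` U \<inter> topspace fell_topology)"
    proof cases
      case 1
      then have "?s -` U \<inter> topspace fell_topology
          = {F. closed F \<and> F \<inter> (\<lambda>y. - a + y) ` K = {}}"
        by (intro set_eqI) (simp only: topspace_fell_topology vimage_eq mem_Collect_eq Int_iff
            closed_shift_iff shift_Int_empty_iff conj_commute conj_left_commute conj_left_absorb)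
      then show ?thesis
        by (simp only: openin_fell_miss compact_translation[OF 1(1)])
    next
      case 2
      then have "?s -` U \<inter> topspace fell_topology
          = {F. closed F \<and> F \<inter> (\<lambda>y. - a + y) ` G \<noteq> {}}"
        by (intro set_eqI) (simp only: topspace_fell_topology vimage_eq mem_Collect_eq Int_iff
            closed_shift_iff shift_Int_empty_iff conj_commute conj_left_commute conj_left_absorb)
      then show ?thesis
        by (simp only: openin_fell_hit open_translation[OF 2(1)])
    qed
  next
    have "\<Union>?B = {F. closed F}"
      using topspace_fell_topology unfolding fell_topology_def topology_generated_by_topspace .
    then show "?s ` topspace fell_topology \<subseteq> \<Union>?B"
      by (simp only: topspace_fell_topology) (auto simp: closed_shift_iff)
  qed
  then show ?thesis by (simp only: fell_topology_def)
qed

lemma random_closed_set_shift: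
  fixes a :: real
  assumes "random_closed_set M Y"
  shows "random_closed_set M (\<lambda>\<omega>. (\<lambda>y. y + a) ` Y \<omega>)"
proof -
  have "(\<lambda>F. (\<lambda>y. y + a) ` F) \<in> measurable fell_borel fell_borel"
    unfolding fell_borel_def
  proof (rule measurable_measure_of[OF openin_fell_subset])
    show "(\<lambda>F. (\<lambda>y. y + a) ` F) \<in> space (sigma {F. closed F} {U. openin fell_topology U})
        \<rightarrow> {F. closed F}"
      unfolding fell_borel_def[symmetric] space_fell_borel
      by (simp only: Pi_iff mem_Collect_eq closed_shift_iff simp_thms Ball_def)
    fix U :: "real set set" assume "U \<in> {U. openin fell_topology U}"
    then have "openin fell_topology {F \<in> topspace fell_topology. (\<lambda>y. y + a) ` F \<in> U}"
      using openin_continuous_map_preimage[OF continuous_map_fell_shift] by blast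
    moreover have "{F \<in> topspace fell_topology. (\<lambda>y. y + a) ` F \<in> U}
        = (\<lambda>F. (\<lambda>y. y + a) ` F) -` U \<inter> space (sigma {F. closed F} {U. openin fell_topology U})"
      unfolding fell_borel_def[symmetric] space_fell_borel topspace_fell_topology by blast
    ultimately show "(\<lambda>F. (\<lambda>y. y + a) ` F) -` U \<inter> space (sigma {F. closed F} {U. openin fell_topology U})
        \<in> sets (sigma {F. closed F} {U. openin fell_topology U})"
      unfolding fell_borel_def[symmetric] sets_fell_borel
      by (simp only: sigma_sets.Basic mem_Collect_eq)
  qed
  then show ?thesis
    using assms measurable_compose unfolding random_closed_set_def by blast
qed

definition stationary_closed_set :: "'w measure \<Rightarrow> ('w \<Rightarrow> real set) \<Rightarrow> bool" where
  "stationary_closed_set M Y \<longleftrightarrow>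
     (\<forall>a. distr M fell_borel (\<lambda>\<omega>. (\<lambda>y. y + a) ` Y \<omega>) = distr M fell_borel Y)"

end

(* Only finitely many points are needed. By Lagrange interpolation, the values of a polynomial of
   degree at most m at m + 2 points satisfy a fixed linear relation with nonzero coefficients.
   The set S of all values of this linear form on the product of the corresponding random sets is
   almost surely countable, hence a Lebesgue null set, so by Fubini a fixed b lies in S with
   probability 0 for almost every b. Shifting one of the sets translates S, hence by independence
   and stationarity the probability of b lying in S does not depend on b, and it is 0 for b = 0. *)

theory Submission
  imports Defs
begin

section \<open>Linear relations between the values of polynomials\<close>

text \<open>Lagrange interpolation at the points of \<open>I - {l}\<close>, evaluated at
  \<open>l\<close>, writes \<open>poly p l\<close> as a combination of the other values with
  coefficients independent of \<open>p\<close>. The coefficient at \<open>l\<close> is singled out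
  because the set at \<open>l\<close> is the one that is shifted later.\<close>

lemma poly_linear_relation:
  fixes I :: "'a::field set"
  assumes fin: "finite I" and l: "l \<in> I"
  obtains c where "c l \<noteq> 0"
    "\<And>p. degree p < card I - 1 \<Longrightarrow> (\<Sum>x\<in>I. c x * poly p x) = 0"
proof -
  define J where "J = I - {l}"
  have J: "finite J" "l \<notin> J" "card J = card I - 1" "I = insert l J"
    using assms by (auto simp: J_def)
  \<comment> \<open>The Lagrange basis polynomials for the nodes \<open>J\<close>.\<close>
  define L where "L x = smult (inverse (\<Prod>y\<in>J-{x}. x - y)) (\<Prod>y\<in>J-{x}. [:-y, 1:])" for x
  have deg_L: "degree (L x) < card J" if "x \<in> J" for x
  proof -
    have "degree (L x) \<le> degree (\<Prod>y\<in>J-{x}. [:-y, 1:])"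
      unfolding L_def by (rule degree_smult_le)
    also have "\<dots> \<le> (\<Sum>y\<in>J-{x}. degree [:-y, 1:])"
      using degree_prod_sum_le[of "J - {x}" "\<lambda>y. [:-y, 1:]"] J(1) by (simp add: o_def)
    also have "\<dots> = card (J - {x})" by simp
    also have "\<dots> < card J" using that J(1) by (intro psubset_card_mono) auto
    finally show ?thesis .
  qed
  have poly_L: "poly (L x) z = (if z = x then 1 else 0)" if "x \<in> J" "z \<in> J" for x z
    using that J(1) by (auto simp: L_def poly_prod)
  have interpolation: "p = (\<Sum>x\<in>J. smult (poly p x) (L x))" if p: "degree p < card J" for p
  proof (rule poly_eqI_degree[where A = J])
    show "poly p z = poly (\<Sum>x\<in>J. smult (poly p x) (L x)) z" if "z \<in> J" for z
      using that J(1) by (simp add: poly_sum poly_L if_distrib sum.delta cong: if_cong)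
    \<comment> \<open>An empty sum has degree 0, so the strict degree bound requires a node.\<close>
    have "card J > 0" using p by simp
    then show "degree (\<Sum>x\<in>J. smult (poly p x) (L x)) < card J"
      using deg_L by (intro degree_sum_less) (auto intro: le_less_trans[OF degree_smult_le])
  qed (use p in auto)
  show ?thesis
  proof (rule that[of "\<lambda>x. if x = l then - 1 else poly (L x) l"])
    fix p :: "'a poly" assume "degree p < card I - 1"
    then have "poly p l = (\<Sum>x\<in>J. poly p x * poly (L x) l)"
      using interpolation[of p] J(3) by (metis (no_types, lifting) poly_smult poly_sum sum.cong)
    moreover have "(\<Sum>x\<in>J. (if x = l then - 1 else poly (L x) l) * poly p x)
        = (\<Sum>x\<in>J. poly p x * poly (L x) l)"
      using J(2) by (intro sum.cong) auto
    ultimately show "(\<Sum>x\<in>I. (if x = l then - 1 else poly (L x) l) * poly p x) = 0"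
      using J by simp
  qed simp
qed

section \<open>Images of products of sets under a linear form\<close>

text \<open>Induction on \<open>I\<close>: a new index adds, in the sense of Minkowski sums, a
  scaled compact set to a compact set. It lets limits of approximate solutions be attained.\<close>

lemma compact_linear_image_Pi:
  fixes K :: "'i \<Rightarrow> real set"
  assumes "finite I" "\<And>i. i \<in> I \<Longrightarrow> compact (K i)"
  shows "compact ((\<lambda>y. \<Sum>i\<in>I. c i * y i) ` Pi I K)"
  using assms
proof (induction I)
  case empty
  then show ?case by simp
next
  case (insert l I)
  have eq: "(\<lambda>y. \<Sum>i\<in>insert l I. c i * y i) ` Pi (insert l I) K
      = {x + y |x y. x \<in> (*\<^sub>R) (c l) ` K l \<and> y \<in> (\<lambda>y. \<Sum>i\<in>I. c i * y i) ` Pi I K}"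
    (is "?A = ?B")
  proof
    show "?A \<subseteq> ?B" using insert(1,2) by auto
    show "?B \<subseteq> ?A"
    proof clarsimp
      fix t y assume ty: "t \<in> K l" "y \<in> Pi I K"
      have "(\<Sum>i\<in>I. c i * (y(l := t)) i) = (\<Sum>i\<in>I. c i * y i)"
        using insert(2) by (intro sum.cong) auto
      then have "c l * t + (\<Sum>i\<in>I. c i * y i) = (\<Sum>i\<in>insert l I. c i * (y(l := t)) i)"
        using insert(1,2) by simp
      moreover have "y(l := t) \<in> Pi (insert l I) K" using ty by auto
      ultimately show "c l * t + (\<Sum>i\<in>I. c i * y i) \<in> ?A" by (rule image_eqI)
    qed
  qed
  show ?case unfolding eq
    using insert by (intro compact_sums compact_scaling) auto
qed

text \<open>\<open>Pi I F\<close> leaves values outside \<open>I\<close> arbitrary and may be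
  uncountable. Restricting to \<open>I\<close> does not change the sums and lands in a countable
  extensional product.\<close>

lemma countable_linear_image_Pi:
  fixes F :: "'i \<Rightarrow> real set"
  assumes "finite I" "\<And>i. i \<in> I \<Longrightarrow> countable (F i)"
  shows "countable ((\<lambda>y. \<Sum>i\<in>I. c i * y i) ` Pi I F)"
proof -
  have "(\<lambda>y. \<Sum>i\<in>I. c i * y i) ` Pi I F \<subseteq> (\<lambda>y. \<Sum>i\<in>I. c i * y i) ` Pi\<^sub>E I F"
  proof
    fix z assume "z \<in> (\<lambda>y. \<Sum>i\<in>I. c i * y i) ` Pi I F"
    then obtain y where y: "y \<in> Pi I F" "z = (\<Sum>i\<in>I. c i * y i)" by blast
    then have "restrict y I \<in> Pi\<^sub>E I F" "z = (\<Sum>i\<in>I. c i * restrict y I i)" by auto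
    then show "z \<in> (\<lambda>y. \<Sum>i\<in>I. c i * y i) ` Pi\<^sub>E I F" by blast
  qed
  then show ?thesis
    using assms by (meson countable_PiE countable_image countable_subset)
qed

text \<open>This turns an existential quantifier over an uncountable set into countable operations.\<close>

lemma mem_linear_image_Pi_iff:
  fixes F :: "'i \<Rightarrow> real set"
  assumes fin: "finite I" and closed: "\<And>i. i \<in> I \<Longrightarrow> closed (F i)"
  shows "b \<in> (\<lambda>y. \<Sum>i\<in>I. c i * y i) ` Pi I F \<longleftrightarrow>
    (\<exists>n::nat. \<forall>k::nat. \<exists>q\<in>I \<rightarrow>\<^sub>E \<rat>.
      (\<forall>i\<in>I. F i \<inter> (cball 0 (real n) \<inter> cball (q i) (inverse (Suc k))) \<noteq> {}) \<and>
      \<bar>(\<Sum>i\<in>I. c i * q i) - b\<bar> \<le> (\<Sum>i\<in>I. \<bar>c i\<bar>) * inverse (Suc k))"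
    (is "?L \<longleftrightarrow> (\<exists>n. \<forall>k. \<exists>q\<in>_. ?P n k q)")
proof -
  \<comment> \<open>Both directions compare a point of the product with a nearby rational point
    through this estimate.\<close>
  have close: "\<bar>(\<Sum>i\<in>I. c i * u i) - (\<Sum>i\<in>I. c i * v i)\<bar> \<le> (\<Sum>i\<in>I. \<bar>c i\<bar>) * \<delta>"
    if "\<And>i. i \<in> I \<Longrightarrow> \<bar>u i - v i\<bar> \<le> \<delta>" for u v :: "'i \<Rightarrow> real" and \<delta>
  proof -
    have "\<bar>(\<Sum>i\<in>I. c i * u i) - (\<Sum>i\<in>I. c i * v i)\<bar> = \<bar>\<Sum>i\<in>I. c i * (u i - v i)\<bar>"
      by (simp add: sum_subtractf algebra_simps)
    also have "\<dots> \<le> (\<Sum>i\<in>I. \<bar>c i\<bar> * \<delta>)"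
      using that by (intro sum_abs[THEN order_trans] sum_mono) (auto simp: abs_mult mult_left_mono)
    finally show ?thesis by (simp add: sum_distrib_right)
  qed
  show ?thesis
  proof
    assume ?L
    then obtain y where y: "\<And>i. i \<in> I \<Longrightarrow> y i \<in> F i" "b = (\<Sum>i\<in>I. c i * y i)" by auto
    obtain n :: nat where n: "(\<Sum>i\<in>I. \<bar>y i\<bar>) \<le> n" using real_arch_simple by blast
    have yn: "\<bar>y i\<bar> \<le> n" if "i \<in> I" for i
      using member_le_sum[OF that, of "\<lambda>i. \<bar>y i\<bar>"] fin n by simp
    have "\<exists>q\<in>I \<rightarrow>\<^sub>E \<rat>. ?P n k q" for k :: nat
    proof -
      have "\<exists>q\<in>\<rat>. \<bar>q - t\<bar> \<le> inverse (Suc k)" for t :: real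
      proof -
        obtain q where "q \<in> \<rat>" "t < q" "q < t + inverse (Suc k)"
          using Rats_dense_in_real[of t "t + inverse (Suc k)"] by auto
        then show ?thesis by (intro bexI[of _ q]) auto
      qed
      then obtain r where r: "\<And>t. r t \<in> \<rat>" "\<And>t. \<bar>r t - t\<bar> \<le> inverse (Suc k)" by metis
      let ?q = "\<lambda>i\<in>I. r (y i)"
      have "y i \<in> F i \<inter> (cball 0 (real n) \<inter> cball (?q i) (inverse (Suc k)))" if "i \<in> I" for i
        using that y(1) yn r(2)[of "y i"] by (simp add: dist_real_def)
      moreover have "\<bar>(\<Sum>i\<in>I. c i * ?q i) - b\<bar> \<le> (\<Sum>i\<in>I. \<bar>c i\<bar>) * inverse (Suc k)"
        unfolding y(2) using r(2) by (intro close) simp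
      moreover have "?q \<in> I \<rightarrow>\<^sub>E \<rat>" using r(1) by auto
      ultimately show ?thesis by blast
    qed
    then show "\<exists>n. \<forall>k. \<exists>q\<in>I \<rightarrow>\<^sub>E \<rat>. ?P n k q" by blast
  next
    assume "\<exists>n. \<forall>k. \<exists>q\<in>I \<rightarrow>\<^sub>E \<rat>. ?P n k q"
    then obtain n :: nat where n: "\<And>k. \<exists>q\<in>I \<rightarrow>\<^sub>E \<rat>. ?P n k q" by blast
    \<comment> \<open>The bound \<open>n\<close> does not depend on \<open>k\<close>, so all
      approximations lie in one compact box and \<open>?S\<close> is closed. Sums of unbounded
      closed sets can fail to be closed.\<close>
    let ?S = "(\<lambda>y. \<Sum>i\<in>I. c i * y i) ` Pi I (\<lambda>i. F i \<inter> cball 0 (real n))"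
    let ?C = "\<Sum>i\<in>I. \<bar>c i\<bar>"
    have "closed ?S"
      using fin closed
      by (intro compact_imp_closed compact_linear_image_Pi) (auto intro: closed_Int_compact)
    moreover have "b \<in> closure ?S"
      unfolding closure_approachable
    proof (intro allI impI)
      fix e :: real assume "e > 0"
      \<comment> \<open>The factor 2 covers the errors from \<open>y\<close> to \<open>q\<close> and
        from \<open>q\<close> to \<open>b\<close>; the summand 1 keeps the denominator positive if
        all coefficients vanish.\<close>
      then have "e / (2 * ?C + 1) > 0" by (simp add: add_nonneg_pos sum_nonneg)
      then obtain k :: nat where k: "inverse (Suc k) < e / (2 * ?C + 1)"
        using reals_Archimedean by blast
      obtain q where q: "?P n k q" using n by blast
      then have "\<forall>i\<in>I. \<exists>t. t \<in> F i \<inter> (cball 0 (real n) \<inter> cball (q i) (inverse (Suc k)))"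
        by blast
      then obtain y where
        y: "\<forall>i\<in>I. y i \<in> F i \<inter> (cball 0 (real n) \<inter> cball (q i) (inverse (Suc k)))"
        unfolding bchoice_iff by blast
      have "\<bar>(\<Sum>i\<in>I. c i * y i) - (\<Sum>i\<in>I. c i * q i)\<bar> \<le> ?C * inverse (Suc k)"
        using y by (intro close) (auto simp: dist_real_def abs_minus_commute)
      then have "\<bar>(\<Sum>i\<in>I. c i * y i) - b\<bar> \<le> 2 * ?C * inverse (Suc k)"
        using q by linarith
      also have "\<dots> \<le> (2 * ?C + 1) * inverse (Suc k)" by (simp add: mult_right_mono)
      also have "\<dots> < e"
        using k by (simp add: add_nonneg_pos sum_nonneg pos_less_divide_eq mult.commute)
      finally show "\<exists>z\<in>?S. dist z b < e"
        using y by (intro bexI[of _ "\<Sum>i\<in>I. c i * y i"]) (auto simp: dist_real_def)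
    qed
    ultimately have "b \<in> ?S" by simp
    then show ?L by auto
  qed
qed

section \<open>Measurability of the linear image\<close>

lemma sets_fell_borel_hit:
  assumes "compact K"
  shows "{F \<in> space fell_borel. F \<inter> K \<noteq> {}} \<in> sets fell_borel"
proof -
  have "{F. closed F \<and> F \<inter> K = {}} \<in> sets fell_borel"
    unfolding sets_fell_borel using openin_fell_miss[OF assms] by (intro sigma_sets.Basic) simp
  then have "space fell_borel - {F. closed F \<and> F \<inter> K = {}} \<in> sets fell_borel" by blast
  also have "space fell_borel - {F. closed F \<and> F \<inter> K = {}} = {F \<in> space fell_borel. F \<inter> K \<noteq> {}}"
    by (auto simp: space_fell_borel)
  finally show ?thesis .
qed

text \<open>The preceding characterization uses only countable operations on events that a set hits
  a compact set. Joint measurability in the sets and the target point is what Fubini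
  requires.\<close>

lemma measurable_linear_image_Pi:
  fixes I :: "'i set"
  assumes fin: "finite I"
  shows "{z \<in> space (Pi\<^sub>M I (\<lambda>_. fell_borel) \<Otimes>\<^sub>M borel).
      snd z \<in> (\<lambda>y. \<Sum>i\<in>I. c i * y i) ` Pi I (fst z)}
    \<in> sets (Pi\<^sub>M I (\<lambda>_. fell_borel) \<Otimes>\<^sub>M (borel :: real measure))" (is "_ \<in> sets ?N")
proof -
  let ?P = "\<lambda>n k q z. (\<forall>i\<in>I. fst z i \<inter> (cball 0 (real n) \<inter> cball (q i) (inverse (Suc k))) \<noteq> {}) \<and>
      \<bar>(\<Sum>i\<in>I. c i * q i) - snd z\<bar> \<le> (\<Sum>i\<in>I. \<bar>c i\<bar>) * inverse (Suc k)"
  have hit: "{z \<in> space ?N. fst z i \<inter> K \<noteq> {}} \<in> sets ?N" if "i \<in> I" "compact K" for i K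
  proof -
    have m: "(\<lambda>z. fst z i) \<in> measurable ?N fell_borel"
      using that(1) by measurable
    show ?thesis
      using measurable_sets[OF m sets_fell_borel_hit[OF that(2)]]
      by (rule back_subst[of "\<lambda>A. A \<in> sets ?N"]) (use measurable_space[OF m] in auto)
  qed
  have P: "{z \<in> space ?N. ?P n k q z} \<in> sets ?N" for n k q
    using fin
    by (intro sets.sets_Collect_conj sets.sets_Collect_finite_All hit) (auto intro: compact_Int)
  \<comment> \<open>Extensionality fixes the values outside the finite set \<open>I\<close>, which
    makes the rational points countable.\<close>
  have "countable (I \<rightarrow>\<^sub>E (\<rat> :: real set))"
    using fin by (intro countable_PiE countable_rat)
  then have "{z \<in> space ?N. \<exists>q\<in>I \<rightarrow>\<^sub>E \<rat>. ?P n k q z} \<in> sets ?N" for n k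
    by (rule sets.sets_Collect_countable_Ex'[rotated]) (rule P)
  then have "{z \<in> space ?N. \<exists>n::nat. \<forall>k::nat. \<exists>q\<in>I \<rightarrow>\<^sub>E \<rat>. ?P n k q z} \<in> sets ?N"
    by (intro sets.sets_Collect_countable_Ex sets.sets_Collect_countable_All)
  also have "{z \<in> space ?N. \<exists>n::nat. \<forall>k::nat. \<exists>q\<in>I \<rightarrow>\<^sub>E \<rat>. ?P n k q z}
      = {z \<in> space ?N. snd z \<in> (\<lambda>y. \<Sum>i\<in>I. c i * y i) ` Pi I (fst z)}"
  proof (rule Collect_cong, rule conj_cong[OF refl])
    fix z assume "z \<in> space ?N"
    then have "closed (fst z i)" if "i \<in> I" for i
      using that by (auto simp: space_pair_measure space_PiM PiE_iff space_fell_borel)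
    then show "(\<exists>n::nat. \<forall>k::nat. \<exists>q\<in>I \<rightarrow>\<^sub>E \<rat>. ?P n k q z)
        \<longleftrightarrow> snd z \<in> (\<lambda>y. \<Sum>i\<in>I. c i * y i) ` Pi I (fst z)"
      by (rule mem_linear_image_Pi_iff[OF fin, symmetric])
  qed
  finally show ?thesis .
qed

section \<open>Fubini and the shift argument\<close>

text \<open>A single level \<open>b\<close> that is almost surely avoided suffices: a shift of
  \<open>Y l\<close> carries it to level 0, and independence together with stationarity shows that
  the joint law is unchanged.\<close>

lemma (in prob_space) AE_no_linear_relation:
  fixes Y :: "'i \<Rightarrow> 'a \<Rightarrow> real set"
  assumes fin: "finite I" and l: "l \<in> I" "c l \<noteq> 0"
    and rcs: "\<And>i. i \<in> I \<Longrightarrow> random_closed_set M (Y i)"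
    and indep: "indep_vars (\<lambda>_. fell_borel) Y I"
    and stat: "stationary_closed_set M (Y l)"
    and count: "\<And>i. i \<in> I \<Longrightarrow> AE \<omega> in M. countable (Y i \<omega>)"
  shows "AE \<omega> in M. 0 \<notin> (\<lambda>y. \<Sum>i\<in>I. c i * y i) ` (\<Pi> i\<in>I. Y i \<omega>)"
proof -
  let ?N = "Pi\<^sub>M I (\<lambda>_. fell_borel) :: ('i \<Rightarrow> real set) measure"
  let ?S = "\<lambda>F. (\<lambda>y. \<Sum>i\<in>I. c i * y i) ` Pi I F"
  have rv: "Y i \<in> measurable M fell_borel" if "i \<in> I" for i
    using rcs[OF that] by (simp add: random_closed_set_def)
  define V where "V = (\<lambda>\<omega>. \<lambda>i\<in>I. Y i \<omega>)"
  have V: "V \<in> measurable M ?N"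
    unfolding V_def using rv by (intro measurable_restrict)
  interpret pair_sigma_finite M lborel ..
  have m: "(\<lambda>z. (V (fst z), snd z)) \<in> measurable (M \<Otimes>\<^sub>M lborel) (?N \<Otimes>\<^sub>M borel)"
    using V by measurable
  have "{z \<in> space (M \<Otimes>\<^sub>M lborel). snd z \<in> ?S (V (fst z))} \<in> sets (M \<Otimes>\<^sub>M lborel)"
    using measurable_sets[OF m measurable_linear_image_Pi[OF fin]]
    by (rule back_subst[of "\<lambda>A. A \<in> sets (M \<Otimes>\<^sub>M lborel)"])
      (use measurable_space[OF m] in auto)
  then have meas: "{z \<in> space (M \<Otimes>\<^sub>M lborel). snd z \<notin> ?S (V (fst z))} \<in> sets (M \<Otimes>\<^sub>M lborel)"
    by (rule sets.sets_Collect_neg)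
  have "AE \<omega> in M. \<forall>i\<in>I. countable (Y i \<omega>)"
    using count fin by (intro AE_finite_allI) auto
  then have "AE \<omega> in M. AE b in lborel. b \<notin> ?S (V \<omega>)"
  proof eventually_elim
    case (elim \<omega>)
    then have "countable (?S (V \<omega>))"
      using fin by (intro countable_linear_image_Pi) (auto simp: V_def)
    then show ?case
      using AE_not_in countable_imp_null_set_lborel by blast
  qed
  then have "AE b in lborel. AE \<omega> in M. b \<notin> ?S (V \<omega>)"
    using AE_commute[OF meas] by simp
  \<comment> \<open>Lebesgue measure is nonzero, so a property of almost every \<open>b\<close>
    holds for some \<open>b\<close>.\<close>
  moreover have "ae_filter lborel \<noteq> (bot :: real filter)"
    by (simp add: ae_filter_eq_bot_iff)
  ultimately obtain b where b: "AE \<omega> in M. b \<notin> ?S (V \<omega>)"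
    using eventually_happens' by blast
  \<comment> \<open>Shifting the set at \<open>l\<close> by \<open>a\<close> changes the linear form
    by \<open>c l * a = - b\<close>.\<close>
  define a where "a = - (b / c l)"
  define s where "s = (\<lambda>i F. if i = l then (\<lambda>y. y + a) ` F else F)"
  have sm: "s i \<in> measurable fell_borel fell_borel" for i
    using random_closed_set_shift[of fell_borel "\<lambda>F. F" a]
    by (auto simp: s_def random_closed_set_def)
  define V' where "V' = (\<lambda>\<omega>. \<lambda>i\<in>I. s i (Y i \<omega>))"
  have V': "V' \<in> measurable M ?N"
    unfolding V'_def using rv sm by (intro measurable_restrict) (auto intro: measurable_compose)
  have ne: "I \<noteq> {}" using l by blast
  \<comment> \<open>By independence both joint laws are products of their marginals, and
    stationarity equates the marginals at \<open>l\<close>.\<close>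
  have "distr M ?N V' = Pi\<^sub>M I (\<lambda>i. distr M fell_borel (\<lambda>\<omega>. s i (Y i \<omega>)))"
    using indep_vars_iff_distr_eq_PiM'[OF ne, of "\<lambda>i \<omega>. s i (Y i \<omega>)" "\<lambda>_. fell_borel"]
      indep_vars_compose2[OF indep sm] measurable_compose[OF rv sm]
    unfolding V'_def by simp
  also have "\<dots> = Pi\<^sub>M I (\<lambda>i. distr M fell_borel (Y i))"
  proof (intro PiM_cong refl)
    show "distr M fell_borel (\<lambda>\<omega>. s i (Y i \<omega>)) = distr M fell_borel (Y i)" for i
      using stat by (cases "i = l") (simp_all add: s_def stationary_closed_set_def)
  qed
  also have "\<dots> = distr M ?N V"
    using indep_vars_iff_distr_eq_PiM'[OF ne, of Y "\<lambda>_. fell_borel"] indep rv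
    unfolding V_def by simp
  finally have same_law: "distr M ?N V' = distr M ?N V" .
  \<comment> \<open>Sections of the jointly measurable set at a fixed level.\<close>
  have meas_b: "{F \<in> space ?N. b' \<notin> ?S F} \<in> sets ?N" for b'
  proof -
    have m: "(\<lambda>F. (F, b')) \<in> measurable ?N (?N \<Otimes>\<^sub>M borel)" by simp
    have "{F \<in> space ?N. b' \<in> ?S F} \<in> sets ?N"
      using measurable_sets[OF m measurable_linear_image_Pi[OF fin]]
      by (rule back_subst[of "\<lambda>A. A \<in> sets ?N"]) (use measurable_space[OF m] in auto)
    then show ?thesis by (rule sets.sets_Collect_neg)
  qed
  \<comment> \<open>Undoing the shift in coordinate \<open>l\<close> turns a solution at level 0 for
    \<open>V'\<close> into one at level \<open>b\<close> for \<open>V\<close>.\<close>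
  have "0 \<in> ?S (V' \<omega>) \<Longrightarrow> b \<in> ?S (V \<omega>)" for \<omega>
  proof -
    assume "0 \<in> ?S (V' \<omega>)"
    then obtain y where "y \<in> Pi I (V' \<omega>)" "0 = (\<Sum>i\<in>I. c i * y i)" by blast
    then have y: "\<And>i. i \<in> I \<Longrightarrow> y i \<in> s i (Y i \<omega>)" "(\<Sum>i\<in>I. c i * y i) = 0"
      by (auto simp: V'_def Pi_iff)
    have mem: "y(l := y l - a) \<in> Pi I (V \<omega>)"
      using y(1) by (fastforce simp: V_def s_def split: if_splits)
    have "(\<Sum>i\<in>I. c i * (y(l := y l - a)) i) = b"
    proof -
      have "(\<Sum>i\<in>I. c i * (y(l := y l - a)) i) = (\<Sum>i\<in>I. c i * y i - (if i = l then c l * a else 0))"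
        by (intro sum.cong) (auto simp: algebra_simps)
      then show ?thesis
        using y(2) fin l by (simp add: sum_subtractf a_def)
    qed
    then show "b \<in> ?S (V \<omega>)"
      by (intro image_eqI[where x = "y(l := y l - a)"] mem) (rule sym)
  qed
  then have "AE \<omega> in M. 0 \<notin> ?S (V' \<omega>)"
    using b by (auto elim: eventually_mono)
  \<comment> \<open>Avoiding 0 depends only on the law, so it passes from \<open>V'\<close> to
    \<open>V\<close>.\<close>
  then have "AE F in distr M ?N V'. 0 \<notin> ?S F"
    using AE_distr_iff[OF V' meas_b] by simp
  then have "AE \<omega> in M. 0 \<notin> ?S (V \<omega>)"
    unfolding same_law using AE_distr_iff[OF V meas_b] by simp
  moreover have "Pi I (V \<omega>) = (\<Pi> i\<in>I. Y i \<omega>)" for \<omega>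
    unfolding V_def by (auto simp: Pi_iff)
  ultimately show ?thesis by simp
qed

section \<open>Application to polynomials of bounded degree\<close>

theorem proposition11:
  fixes M :: "'w measure" and X :: "real set" and Y :: "real \<Rightarrow> 'w \<Rightarrow> real set"
  assumes "prob_space M" and "complete_measure M"
    and "countable X" and "infinite X"
    and "\<And>x. x \<in> X \<Longrightarrow> random_closed_set M (Y x)"
    and "prob_space.indep_vars M (\<lambda>_. fell_borel) Y X"
    and "\<And>x. x \<in> X \<Longrightarrow> measure M {\<omega> \<in> space M. Y x \<omega> = {}} = 0"
    and "\<And>x. x \<in> X \<Longrightarrow> stationary_closed_set M (Y x)"
    and "\<And>x. x \<in> X \<Longrightarrow> AE \<omega> in M. countable (Y x \<omega>)"
  shows "\<forall>m::nat.
    {\<omega> \<in> space M. \<exists>p::real poly. degree p \<le> m \<and> (\<forall>x\<in>X. poly p x \<in> Y x \<omega>)} \<in> sets M \<and>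
    measure M {\<omega> \<in> space M. \<exists>p::real poly. degree p \<le> m \<and> (\<forall>x\<in>X. poly p x \<in> Y x \<omega>)} = 0"
proof
  fix m :: nat
  interpret prob_space M by fact
  interpret complete_measure M by fact
  \<comment> \<open>With \<open>m + 2\<close> points, \<open>card I - 1 = m + 1\<close> strictly
    exceeds every degree up to \<open>m\<close>, as the linear relation demands.\<close>
  obtain I where I: "I \<subseteq> X" "finite I" "card I = m + 2"
    using infinite_arbitrarily_large[OF assms(4)] by blast
  then obtain l where l: "l \<in> I" by fastforce
  obtain c where c: "c l \<noteq> 0"
    "\<And>p. degree p < card I - 1 \<Longrightarrow> (\<Sum>x\<in>I. c x * poly p x) = 0"
    using poly_linear_relation[OF I(2) l] by blast
  have "AE \<omega> in M. 0 \<notin> (\<lambda>y. \<Sum>x\<in>I. c x * y x) ` (\<Pi> x\<in>I. Y x \<omega>)"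
    using I l c(1) assms(5,8,9) indep_vars_subset[OF assms(6) I(1)]
    by (intro AE_no_linear_relation[where l = l]) auto
  then have "AE \<omega> in M. \<not> (\<exists>p. degree p \<le> m \<and> (\<forall>x\<in>X. poly p x \<in> Y x \<omega>))"
  proof eventually_elim
    case (elim \<omega>)
    show ?case
    proof
      assume "\<exists>p. degree p \<le> m \<and> (\<forall>x\<in>X. poly p x \<in> Y x \<omega>)"
      then obtain p where p: "degree p \<le> m" "\<forall>x\<in>X. poly p x \<in> Y x \<omega>" by blast
      then have "0 = (\<Sum>x\<in>I. c x * poly p x)" "poly p \<in> (\<Pi> x\<in>I. Y x \<omega>)"
        using c(2)[of p] I by auto
      with elim show False by blast
    qed
  qed
  \<comment> \<open>Completeness enters here: the exceptional set of an almost sure statement is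
    itself measurable.\<close>
  then have "{\<omega> \<in> space M. \<exists>p. degree p \<le> m \<and> (\<forall>x\<in>X. poly p x \<in> Y x \<omega>)} \<in> null_sets M"
    by (simp add: AE_iff_null_sets)
  then show "{\<omega> \<in> space M. \<exists>p. degree p \<le> m \<and> (\<forall>x\<in>X. poly p x \<in> Y x \<omega>)} \<in> sets M \<and>
    measure M {\<omega> \<in> space M. \<exists>p. degree p \<le> m \<and> (\<forall>x\<in>X. poly p x \<in> Y x \<omega>)} = 0"
    by (auto simp: measure_eq_0_null_sets)
qed

end
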